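(* Let $V$ be an AM-algebra with unit $\mathbf{e}$, let $\operatorname{int}(V_+)$ be the $\|\cdot\|_{\mathbf{e}}$-interior of $V_+$, let $m\in\mathbb{N}$, let $\tilde\rho:\operatorname{int}(V_+)\to(0,\infty]^m$ be a map, and set $\rho=\log\circ\tilde\rho\circ\exp:V\to(-\infty,\infty]^m$. Then: (i) $\tilde\rho$ is a return risk measure if and only if $\rho$ is a monetary risk measure (for $\mathbf{e}$); (ii) $\tilde\rho$ is GG-convex if and only if $\rho$ is convex; (iii) for every topology $\tau$ on $V$, $\tilde\rho$ is $\exp(\tau)$-lower semicontinuous if and only if $\rho$ is $\tau$-lower semicontinuous; (iv) if $m=1$, then $\tilde\rho$ is proper if and only if $\rho$ is proper.
   Context: An AM-space with unit $\mathbf{e}$ is a Banach lattice $V$ with order unit $\mathbf{e}$ (i.e. $\mathbf{e}>0$ and for every $x$ there is $\lambda>0$ with $|x|\le\lambda\mathbf{e}$) equipped with the norm $\|x\|_{\mathbf{e}}=\inf\{\lambda>0:|x|\le\lambda\mathbf{e}\}$; $V_+=\{x:x\ge0\}$. An AM-algebra with unit $\mathbf{e}$ is an AM-space with unit $\mathbf{e}$ that is also a real associative algebra such that products of positive elements are positive, the norm is submultiplicative, and $\mathbf{e}$ is also the multiplicative identity. There are a compact Hausdorff $K$ and a surjective lattice and algebra isometry $\Phi:V\to C(K)$ (pointwise operations) with $\Phi(\mathbf{e})=\mathbf{1}_K$; functions of elements of $V$ are defined through it: $\exp(x)=\Phi^{-1}(\exp\circ\Phi(x))$ for $x\in V$,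 $x^t=\Phi^{-1}((\Phi(x))^t)$ for $x\in V_+,t\ge0$. The map $\exp$ is a bijection from $V$ onto $\operatorname{int}(V_+)$ with inverse $\log$. On $(0,\infty]^m$, $\log$ is applied componentwise, with $\log\infty=\infty$. A map $\tilde\rho:\operatorname{int}(V_+)\to(0,\infty]^m$ is a return risk measure if it is monotone ($x\le y\Rightarrow\tilde\rho(x)\le\tilde\rho(y)$) and positively homogeneous ($\tilde\rho(\lambda x)=\lambda\tilde\rho(x)$ for $\lambda\in(0,\infty)$); it is GG-convex if $\tilde\rho(x^\lambda y^{1-\lambda})\le\tilde\rho(x)^\lambda\tilde\rho(y)^{1-\lambda}$ (componentwise, $\infty^\lambda=\infty$) for all $x,y\in\operatorname{int}(V_+)$, $\lambda\in(0,1)$. A map $\rho:V\to[-\infty,\infty]^m$ is a monetary risk measure (for $\mathbf{e}$) if it is monotone and $\rho(x+c\,\mathbf{e})=\rho(x)+c(1,\dots,1)^\intercal$ for all $x\in V$, $c\in\mathbb{R}$. For a topology $\tau$ on $V$, $\exp(\tau):=\{\exp(U):U\in\tau\}$, a topology on $\operatorname{int}(V_+)$. For vector-valued maps inequalities, convexity and lower semicontinuity are understood componentwise. A $[-\infty,\infty]$-valued map is proper if it never takes the value $-\infty$ and is not identically $\infty$. *)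

theory Defs
  imports "HOL-Analysis.Analysis" "HOL-Library.Lattice_Algebras"
begin

section \<open>AM-spaces and AM-algebras with unit\<close>

class banach_lattice = banach + ordered_real_vector + lattice_ab_group_add_abs +
  assumes norm_lattice: "\<bar>x\<bar> \<le> \<bar>y\<bar> \<Longrightarrow> norm x \<le> norm y"

class am_space = banach_lattice +
  fixes order_unit :: 'a (\<open>\<e>\<close>)
  assumes order_unit_pos: "0 < \<e>"
    and order_unit: "\<exists>l>0. \<bar>x\<bar> \<le> l *\<^sub>R \<e>"
    and norm_order_unit: "norm x = Inf {l. 0 < l \<and> \<bar>x\<bar> \<le> l *\<^sub>R \<e>}"

text \<open>Submultiplicativity of the norm is part of \<^class>\<open>real_normed_algebra_1\<close>, whose further
  axioms \<open>norm 1 = 1\<close> and \<open>0 \<noteq> 1\<close> follow from the other axioms of the class.\<close>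

class am_algebra = am_space + real_normed_algebra_1 +
  assumes mult_nonneg: "0 \<le> x \<Longrightarrow> 0 \<le> y \<Longrightarrow> 0 \<le> x * y"
    and order_unit_eq_one: "\<e> = 1"

abbreviation positive_cone :: "'a::banach_lattice set" where
  "positive_cone \<equiv> {x. 0 \<le> x}"


section \<open>Functional calculus through a representation on \<open>C(K)\<close>\<close>

text \<open>The elements of \<open>C(K)\<close> are made extensional, so that equality in \<open>C(K)\<close> is equality of HOL
  functions.\<close>

definition continuous_functions :: "'k topology \<Rightarrow> ('k \<Rightarrow> real) set" where
  "continuous_functions K =
     {f \<in> extensional (topspace K). continuous_map K euclideanreal f}"

definition am_representation ::
    "'k topology \<Rightarrow> ('a::am_algebra \<Rightarrow> 'k \<Rightarrow> real) \<Rightarrow> bool" where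
  "am_representation K \<Phi> \<longleftrightarrow>
     compact_space K \<and> Hausdorff_space K \<and>
     range \<Phi> = continuous_functions K \<and>
     (\<forall>x y. \<Phi> (x + y) = (\<lambda>k\<in>topspace K. \<Phi> x k + \<Phi> y k)) \<and>
     (\<forall>c x. \<Phi> (c *\<^sub>R x) = (\<lambda>k\<in>topspace K. c * \<Phi> x k)) \<and>
     (\<forall>x y. \<Phi> (x * y) = (\<lambda>k\<in>topspace K. \<Phi> x k * \<Phi> y k)) \<and>
     (\<forall>x y. \<Phi> (sup x y) = (\<lambda>k\<in>topspace K. max (\<Phi> x k) (\<Phi> y k))) \<and>
     (\<forall>x y. \<Phi> (inf x y) = (\<lambda>k\<in>topspace K. min (\<Phi> x k) (\<Phi> y k))) \<and>
     \<Phi> \<e> = (\<lambda>k\<in>topspace K. 1) \<and>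
     (\<forall>x. norm x = (SUP k\<in>topspace K. \<bar>\<Phi> x k\<bar>))"

text \<open>A fixed representation \<open>(K, \<Phi>)\<close> of \<open>V\<close>. The points of \<open>K\<close> may be taken in \<open>V \<Rightarrow> \<real>\<close>, since
  any \<open>K\<close> embeds there by sending \<open>k\<close> to the evaluation \<open>\<lambda>x. \<Phi> x k\<close>. The functions of
  elements of \<open>V\<close> defined from it do not depend on the choice.\<close>

definition am_rep ::
    "('a::am_algebra \<Rightarrow> real) topology \<times> ('a \<Rightarrow> ('a \<Rightarrow> real) \<Rightarrow> real)" where
  "am_rep = (SOME (K, \<Phi>). am_representation K \<Phi>)"

definition am_apply :: "(real \<Rightarrow> real) \<Rightarrow> 'a::am_algebra \<Rightarrow> 'a" where
  "am_apply g x = (case am_rep of (K, \<Phi>) \<Rightarrow> inv \<Phi> (\<lambda>k\<in>topspace K. g (\<Phi> x k)))"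

definition am_exp :: "'a::am_algebra \<Rightarrow> 'a" where
  "am_exp = am_apply exp"

text \<open>Meaningful for \<open>x \<ge> 0\<close> and \<open>t \<ge> 0\<close>. The case distinction gives \<open>s\<^sup>0 = 1\<close> also at \<open>s = 0\<close>,
  where \<open>0 powr 0 = 0\<close>.\<close>

definition am_powr :: "'a::am_algebra \<Rightarrow> real \<Rightarrow> 'a" where
  "am_powr x t = am_apply (\<lambda>s. if t = 0 then 1 else s powr t) x"


section \<open>Logarithm and powers on \<open>(0,\<infinity>]\<close>\<close>

definition elog :: "ereal \<Rightarrow> ereal" where
  "elog a = (if a = \<infinity> then \<infinity> else ereal (ln (real_of_ereal a)))"

definition vlog :: "ereal^'m \<Rightarrow> ereal^'m" where
  "vlog a = (\<chi> i. elog (a $ i))"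

definition epowr :: "ereal \<Rightarrow> real \<Rightarrow> ereal" where
  "epowr a t = (if a = \<infinity> then \<infinity> else ereal (real_of_ereal a powr t))"


section \<open>Risk measures\<close>

text \<open>Maps on \<open>int V\<^sub>+\<close> are total functions on \<open>V\<close> of which only the values on \<open>int V\<^sub>+\<close> matter. The
  order on \<open>ereal^'m\<close> is the componentwise one.\<close>

definition return_risk_measure :: "('a::am_algebra \<Rightarrow> ereal^'m) \<Rightarrow> bool" where
  "return_risk_measure r \<longleftrightarrow>
     (\<forall>x\<in>interior positive_cone. \<forall>i. 0 < r x $ i) \<and>
     (\<forall>x\<in>interior positive_cone. \<forall>y\<in>interior positive_cone. x \<le> y \<longrightarrow> r x \<le> r y) \<and>
     (\<forall>x\<in>interior positive_cone. \<forall>l>0. \<forall>i. r (l *\<^sub>R x) $ i = ereal l * r x $ i)"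

definition GG_convex :: "('a::am_algebra \<Rightarrow> ereal^'m) \<Rightarrow> bool" where
  "GG_convex r \<longleftrightarrow>
     (\<forall>x\<in>interior positive_cone. \<forall>y\<in>interior positive_cone. \<forall>l. 0 < l \<and> l < 1 \<longrightarrow>
        (\<forall>i. r (am_powr x l * am_powr y (1 - l)) $ i
               \<le> epowr (r x $ i) l * epowr (r y $ i) (1 - l)))"

definition monetary_risk_measure :: "('a::am_space \<Rightarrow> ereal^'m) \<Rightarrow> bool" where
  "monetary_risk_measure r \<longleftrightarrow>
     (\<forall>x y. x \<le> y \<longrightarrow> r x \<le> r y) \<and>
     (\<forall>x c. \<forall>i. r (x + c *\<^sub>R \<e>) $ i = r x $ i + ereal c)"

text \<open>Used for maps avoiding \<open>-\<infinity>\<close>, so that no sum \<open>\<infinity> + (-\<infinity>)\<close> occurs.\<close>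

definition convex_map :: "('a::real_vector \<Rightarrow> ereal^'m) \<Rightarrow> bool" where
  "convex_map r \<longleftrightarrow>
     (\<forall>x y l. 0 < l \<and> l < 1 \<longrightarrow>
        (\<forall>i. r (l *\<^sub>R x + (1 - l) *\<^sub>R y) $ i
               \<le> ereal l * r x $ i + ereal (1 - l) * r y $ i))"

definition lsc :: "'a topology \<Rightarrow> ('a \<Rightarrow> ereal^'m) \<Rightarrow> bool" where
  "lsc X r \<longleftrightarrow>
     (\<forall>i. \<forall>a::real. closedin X {x \<in> topspace X. r x $ i \<le> ereal a})"

definition exp_topology :: "'a::am_algebra topology \<Rightarrow> 'a topology" where
  "exp_topology \<tau> = topology (\<lambda>W. \<exists>U. openin \<tau> U \<and> W = am_exp ` U)"

definition proper_on :: "'a set \<Rightarrow> ('a \<Rightarrow> ereal) \<Rightarrow> bool" where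
  "proper_on S f \<longleftrightarrow> (\<forall>x\<in>S. f x \<noteq> -\<infinity>) \<and> (\<exists>x\<in>S. f x \<noteq> \<infinity>)"

end

theory Submission
  imports Defs
begin

text \<open>The exponential is an order isomorphism from \<open>V\<close> onto \<open>int V\<^sub>+\<close> that turns addition of
  \<open>c \<e>\<close> into scaling by \<open>exp c\<close> and convex combinations into geometric ones, and \<open>elog\<close> does the
  inverse on the values. So each property of one map is the transported property of the other.

  These facts about the exponential are pointwise once \<open>am_rep\<close> is known to be a representation.
  For its existence, take for \<open>K\<close> the normalised lattice homomorphisms \<open>V \<rightarrow> \<real>\<close>, compact in the
  product topology. They are multiplicative because their kernels are ideals, and they are the
  minimal elements among the functionals that behave like \<open>x \<mapsto> max x(F)\<close> for closed
  \<open>F \<subseteq> K\<close>. Zorn's lemma below such a functional therefore shows that they attain the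
  norm. Surjectivity follows from the Stone-Weierstrass theorem and completeness.\<close>

section \<open>Directed infima\<close>

text \<open>A single index below near-minimisers of \<open>f\<close> and of \<open>g\<close> bounds
  both terms of the maximum at once. This lets directed infima preserve \<open>sup\<close>.\<close>

lemma INF_max_directed:
  fixes f g :: "'i \<Rightarrow> real"
  assumes "I \<noteq> {}" "bdd_below (f ` I)" "bdd_below (g ` I)"
    and dir: "\<And>i j. i \<in> I \<Longrightarrow> j \<in> I \<Longrightarrow> \<exists>k\<in>I. f k \<le> f i \<and> g k \<le> g j"
  shows "(INF i\<in>I. max (f i) (g i)) = max (INF i\<in>I. f i) (INF i\<in>I. g i)"
proof (rule antisym)
  have bd: "bdd_below ((\<lambda>i. max (f i) (g i)) ` I)"
    using assms(2) by (auto simp: bdd_below_def le_max_iff_disj)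
  show "(INF i\<in>I. max (f i) (g i)) \<le> max (INF i\<in>I. f i) (INF i\<in>I. g i)"
  proof (rule field_le_epsilon)
    fix e :: real assume "0 < e"
    then have "(INF i\<in>I. f i) < (INF i\<in>I. f i) + e" "(INF i\<in>I. g i) < (INF i\<in>I. g i) + e" by auto
    then obtain i j where "i \<in> I" "f i < (INF i\<in>I. f i) + e" "j \<in> I" "g j < (INF i\<in>I. g i) + e"
      using assms(1-3) by (meson cINF_less_iff)
    moreover from this obtain k where "k \<in> I" "f k \<le> f i" "g k \<le> g j" using dir by blast
    moreover have "(INF i\<in>I. max (f i) (g i)) \<le> max (f k) (g k)"
      using bd \<open>k \<in> I\<close> by (rule cINF_lower)
    ultimately show "(INF i\<in>I. max (f i) (g i)) \<le> max (INF i\<in>I. f i) (INF i\<in>I. g i) + e"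
      by linarith
  qed
  show "max (INF i\<in>I. f i) (INF i\<in>I. g i) \<le> (INF i\<in>I. max (f i) (g i))"
    by (rule cINF_greatest[OF assms(1)])
      (meson assms(2,3) cINF_lower max.mono)
qed

text \<open>With \<open>j\<close> fixed the infimum is taken over \<open>i\<close>, and only then
  over \<open>j\<close>. This carries subadditivity over to infima.\<close>

lemma INF_add_le_directed:
  fixes f g h :: "'i \<Rightarrow> real"
  assumes "I \<noteq> {}" "bdd_below (h ` I)"
    and dir: "\<And>i j. i \<in> I \<Longrightarrow> j \<in> I \<Longrightarrow> \<exists>k\<in>I. h k \<le> f i + g j"
  shows "(INF i\<in>I. h i) \<le> (INF i\<in>I. f i) + (INF i\<in>I. g i)"
proof -
  have "(INF i\<in>I. h i) - g j \<le> (INF i\<in>I. f i)" if "j \<in> I" for j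
  proof (rule cINF_greatest[OF assms(1)])
    fix i assume "i \<in> I"
    with that obtain k where "k \<in> I" "h k \<le> f i + g j" using dir by blast
    moreover have "(INF i\<in>I. h i) \<le> h k"
      using assms(2) \<open>k \<in> I\<close> by (rule cINF_lower)
    ultimately show "(INF i\<in>I. h i) - g j \<le> f i" by linarith
  qed
  then have "(INF i\<in>I. h i) - (INF i\<in>I. f i) \<le> (INF i\<in>I. g i)"
    by (intro cINF_greatest[OF assms(1)]) (simp add: algebra_simps)
  then show ?thesis by simp
qed

lemma INF_add_right:
  fixes f :: "'i \<Rightarrow> real"
  assumes "I \<noteq> {}" "bdd_below (f ` I)"
  shows "(INF i\<in>I. f i + c) = (INF i\<in>I. f i) + c"
proof -
  have bd: "bdd_below ((\<lambda>i. f i + c) ` I)"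
    using assms(2) by (auto simp: bdd_below_def) (metis add_right_mono)
  have "(INF i\<in>I. f i + c) - c \<le> (INF i\<in>I. f i)"
    by (rule cINF_greatest[OF assms(1)]) (use cINF_lower[OF bd] in \<open>auto simp: algebra_simps\<close>)
  moreover have "(INF i\<in>I. f i) + c \<le> (INF i\<in>I. f i + c)"
    by (rule cINF_greatest[OF assms(1)]) (use cINF_lower[OF assms(2)] in auto)
  ultimately show ?thesis by linarith
qed

lemma INF_mult_left:
  fixes f :: "'i \<Rightarrow> real"
  assumes "I \<noteq> {}" "bdd_below (f ` I)" "c > 0"
  shows "(INF i\<in>I. c * f i) = c * (INF i\<in>I. f i)"
proof -
  obtain b where b: "b \<le> f i" if "i \<in> I" for i using assms(2) by (auto simp: bdd_below_def)
  have bd: "bdd_below ((\<lambda>i. c * f i) ` I)"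
    by (rule bdd_belowI2[where m="c*b"]) (use b assms(3) in auto)
  have "(INF i\<in>I. c * f i) / c \<le> (INF i\<in>I. f i)"
    by (rule cINF_greatest[OF assms(1)])
       (use cINF_lower[OF bd] assms(3) in \<open>auto simp: pos_divide_le_eq mult.commute\<close>)
  moreover have "c * (INF i\<in>I. f i) \<le> (INF i\<in>I. c * f i)"
    by (rule cINF_greatest[OF assms(1)]) (use cINF_lower[OF assms(2)] assms(3) in auto)
  ultimately show ?thesis using assms(3) by (simp add: pos_divide_le_eq mult.commute)
qed

section \<open>Functionals of maximum type\<close>

text \<open>The clauses abstract the maximum over a nonempty closed set of points of K. Monotonicity
  comes from the \<open>sup\<close> clause, and \<open>p 0 = 0\<close> from homogeneity.\<close>

definition max_functional :: "('a::am_space \<Rightarrow> real) \<Rightarrow> bool" where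
  "max_functional p \<longleftrightarrow>
     (\<forall>x c. p (x + c *\<^sub>R \<e>) = p x + c) \<and>
     (\<forall>x c. 0 < c \<longrightarrow> p (c *\<^sub>R x) = c * p x) \<and>
     (\<forall>x y. p (x + y) \<le> p x + p y) \<and>
     (\<forall>x y. p (sup x y) = max (p x) (p y))"

lemma order_unit_scale_le_iff: "c *\<^sub>R (\<e>::'a::am_space) \<le> d *\<^sub>R \<e> \<longleftrightarrow> c \<le> d"
proof
  assume le: "c *\<^sub>R (\<e>::'a) \<le> d *\<^sub>R \<e>"
  show "c \<le> d"
  proof (rule ccontr)
    assume "\<not> c \<le> d"
    then have "(1 / (c - d)) *\<^sub>R ((c - d) *\<^sub>R (\<e>::'a)) \<le> (1 / (c - d)) *\<^sub>R 0"
      using le by (intro scaleR_left_mono) (auto simp: algebra_simps)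
    then show False using order_unit_pos[where 'a='a] \<open>\<not> c \<le> d\<close> by (simp add: less_le_not_le)
  qed
next
  assume "c \<le> d"
  then show "c *\<^sub>R (\<e>::'a) \<le> d *\<^sub>R \<e>"
    using order_unit_pos[where 'a='a] by (intro scaleR_right_mono) auto
qed

context
  fixes p :: "'a::am_space \<Rightarrow> real"
  assumes p: "max_functional p"
begin

lemma max_functional_translate: "p (x + c *\<^sub>R \<e>) = p x + c"
  and max_functional_scale: "0 < c \<Longrightarrow> p (c *\<^sub>R x) = c * p x"
  and max_functional_subadd: "p (x + y) \<le> p x + p y"
  and max_functional_sup: "p (sup x y) = max (p x) (p y)"
  using p by (auto simp: max_functional_def)

lemma max_functional_zero: "p 0 = 0"
  using max_functional_scale[of 2 0] by simp

lemma max_functional_unit: "p (c *\<^sub>R \<e>) = c"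
  using max_functional_translate[of 0 c] by (simp add: max_functional_zero)

lemma max_functional_mono: "x \<le> y \<Longrightarrow> p x \<le> p y"
  using max_functional_sup[of x y] by (metis max.cobounded1 sup_absorb2)

lemma max_functional_scale_nonneg: "0 \<le> c \<Longrightarrow> p (c *\<^sub>R x) = c * p x"
  using max_functional_scale[of c x] by (cases "c = 0") (auto simp: max_functional_zero)

lemma max_functional_minus: "- p (- x) \<le> p x"
  using max_functional_subadd[of x "- x"] by (simp add: max_functional_zero)

text \<open>The bound at \<open>x\<close> is the same for all such functionals; with the matching
  lower bound it keeps infima over families of them finite.\<close>

lemma max_functional_le_norm: "p x \<le> norm x"
  unfolding norm_order_unit
proof (rule cInf_greatest)
  show "{l. 0 < l \<and> \<bar>x\<bar> \<le> l *\<^sub>R \<e>} \<noteq> {}" using order_unit[of x] by auto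
  fix l assume "l \<in> {l. 0 < l \<and> \<bar>x\<bar> \<le> l *\<^sub>R \<e>}"
  then have "x \<le> l *\<^sub>R \<e>" using abs_ge_self order_trans by blast
  then show "p x \<le> l" using max_functional_mono max_functional_unit by metis
qed

lemma max_functional_ge_norm: "- norm x \<le> p x"
  using max_functional_le_norm[of "- x"] max_functional_minus[of x] by simp

lemma max_functional_abs_of_odd:
  assumes "p (- x) = - p x" shows "p \<bar>x\<bar> = \<bar>p x\<bar>"
proof -
  have "p \<bar>x\<bar> = max (p x) (- p x)" by (simp only: abs_lattice[of x] max_functional_sup assms)
  then show ?thesis by linarith
qed

text \<open>In the model case \<open>p x = max x(F)\<close> for a closed set \<open>F \<subseteq> K\<close>, the functional below is the
  maximum over the smaller set \<open>{k \<in> F. z k = 0}\<close>.\<close>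

lemma max_functional_restrict:
  assumes z: "p z = 0"
  shows "\<exists>q. max_functional q \<and> q \<le> p \<and> q (- z) \<le> 0"
proof -
  \<comment> \<open>In the model \<open>z \<le> 0\<close> on F with value 0 attained, so adding
    \<open>t *\<^sub>R z\<close> for large \<open>t\<close> pushes down all values off the zero set
    of \<open>z\<close>.\<close>
  define q where "q x = (INF t\<in>{0..}. p (x + t *\<^sub>R z))" for x
  \<comment> \<open>Since \<open>p z = 0\<close>, a larger parameter can only lower the value, so
    the family is directed.\<close>
  have anti: "p (x + s *\<^sub>R z) \<le> p (x + t *\<^sub>R z)" if "0 \<le> t" "t \<le> s" for x s t
    using max_functional_subadd[of "x + t *\<^sub>R z" "(s - t) *\<^sub>R z"]
      max_functional_scale_nonneg[of "s - t" z] that z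
    by (simp add: algebra_simps)
  have lower: "- p (- x) \<le> p (x + t *\<^sub>R z)" if "0 \<le> t" for x t
    using max_functional_subadd[of "x + t *\<^sub>R z" "- x"]
      max_functional_scale_nonneg[of t z] that z
    by simp
  have bd: "bdd_below ((\<lambda>t. p (x + t *\<^sub>R z)) ` {0..})" for x
    using lower by (intro bdd_belowI2) auto
  have ne: "{0::real..} \<noteq> {}" by auto
  have "q (x + c *\<^sub>R \<e>) = q x + c" for x c
    unfolding q_def INF_add_right[OF ne bd, symmetric]
    using max_functional_translate[of "x + _ *\<^sub>R z" c] by (simp add: algebra_simps)
  moreover have "q (c *\<^sub>R x) = c * q x" if c: "0 < c" for x c
  proof -
    \<comment> \<open>The substitution of \<open>c * t\<close> for \<open>t\<close> permutes the
      nonnegative reals, so both infima run over the same values.\<close>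
    have "(\<lambda>t. p (c *\<^sub>R x + t *\<^sub>R z)) ` {0..} = (\<lambda>t. c * p (x + t *\<^sub>R z)) ` {0..}"
    proof -
      have *: "c * p (x + t *\<^sub>R z) = p (c *\<^sub>R x + (c * t) *\<^sub>R z)" for t
        using max_functional_scale[OF c, of "x + t *\<^sub>R z"] by (simp add: algebra_simps)
      have im: "(\<lambda>t. c * t) ` {0..} = {0..}"
        using c by (auto simp: image_iff intro!: bexI[of _ "_ / c"])
      have "(\<lambda>t. p (c *\<^sub>R x + t *\<^sub>R z)) ` {0..} = (\<lambda>t. p (c *\<^sub>R x + t *\<^sub>R z)) ` ((\<lambda>t. c * t) ` {0..})"
        by (simp only: im)
      then show ?thesis by (simp add: image_image *)
    qed
    then show ?thesis
      unfolding q_def INF_mult_left[OF ne bd c, symmetric] by simp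
  qed
  moreover have "q (x + y) \<le> q x + q y" for x y
    unfolding q_def
  proof (rule INF_add_le_directed[OF ne bd])
    fix s t :: real assume "s \<in> {0..}" "t \<in> {0..}"
    then show "\<exists>r\<in>{0..}. p (x + y + r *\<^sub>R z) \<le> p (x + s *\<^sub>R z) + p (y + t *\<^sub>R z)"
      using max_functional_subadd[of "x + s *\<^sub>R z" "y + t *\<^sub>R z"]
      by (intro bexI[of _ "s + t"]) (auto simp: algebra_simps)
  qed
  moreover have "q (sup x y) = max (q x) (q y)" for x y
  proof -
    have "p (sup x y + t *\<^sub>R z) = max (p (x + t *\<^sub>R z)) (p (y + t *\<^sub>R z))" for t
      by (simp add: add_sup_distrib_right max_functional_sup)
    then have "q (sup x y) = (INF t\<in>{0..}. max (p (x + t *\<^sub>R z)) (p (y + t *\<^sub>R z)))"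
      by (simp add: q_def)
    also have "\<dots> = max (q x) (q y)"
      unfolding q_def
    proof (rule INF_max_directed[OF ne bd bd])
      fix s t :: real assume "s \<in> {0..}" "t \<in> {0..}"
      then show "\<exists>r\<in>{0..}. p (x + r *\<^sub>R z) \<le> p (x + s *\<^sub>R z) \<and> p (y + r *\<^sub>R z) \<le> p (y + t *\<^sub>R z)"
        using anti by (intro bexI[of _ "max s t"]) auto
    qed
    finally show ?thesis .
  qed
  moreover have "q x \<le> p x" for x
    using cINF_lower[OF bd, of 0 x] by (simp add: q_def)
  moreover have "q (- z) \<le> 0"
    using cINF_lower[OF bd, of 1 "- z"] by (simp add: q_def max_functional_zero)
  ultimately show ?thesis unfolding max_functional_def le_fun_def by blast
qed

end

text \<open>A chain is downward directed, so the lemmas on directed infima apply. This supplies the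
  lower bounds for Zorn's lemma.\<close>

lemma max_functional_chain_INF:
  fixes C :: "('a::am_space \<Rightarrow> real) set"
  assumes ne: "C \<noteq> {}" and C: "\<And>p. p \<in> C \<Longrightarrow> max_functional p"
    and chain: "\<And>p q. p \<in> C \<Longrightarrow> q \<in> C \<Longrightarrow> p \<le> q \<or> q \<le> p"
  shows "max_functional (\<lambda>x. INF p\<in>C. p x)"
proof -
  have bd: "bdd_below ((\<lambda>p. p x) ` C)" for x
    using max_functional_ge_norm C by (intro bdd_belowI2) auto
  have dir: "\<exists>r\<in>C. r \<le> p \<and> r \<le> q" if "p \<in> C" "q \<in> C" for p q
    using chain[OF that] that by blast
  have "(INF p\<in>C. p (x + c *\<^sub>R \<e>)) = (INF p\<in>C. p x) + c" for x c
    using INF_add_right[OF ne bd] C by (simp add: max_functional_translate)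
  moreover have "(INF p\<in>C. p (c *\<^sub>R x)) = c * (INF p\<in>C. p x)" if "0 < c" for x c
    using INF_mult_left[OF ne bd that] C that by (simp add: max_functional_scale)
  moreover have "(INF p\<in>C. p (x + y)) \<le> (INF p\<in>C. p x) + (INF p\<in>C. p y)" for x y
  proof (rule INF_add_le_directed[OF ne bd])
    fix p q assume "p \<in> C" "q \<in> C"
    with dir obtain r where r: "r \<in> C" "r \<le> p" "r \<le> q" by blast
    have "r (x + y) \<le> r x + r y" using C r(1) by (simp add: max_functional_subadd)
    also have "\<dots> \<le> p x + q y" using r by (simp add: le_funD add_mono)
    finally show "\<exists>r\<in>C. r (x + y) \<le> p x + q y" using r by blast
  qed
  moreover have "(INF p\<in>C. p (sup x y)) = max (INF p\<in>C. p x) (INF p\<in>C. p y)" for x y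
  proof -
    have "(INF p\<in>C. p (sup x y)) = (INF p\<in>C. max (p x) (p y))"
      using C by (simp add: max_functional_sup)
    also have "\<dots> = max (INF p\<in>C. p x) (INF p\<in>C. p y)"
      by (rule INF_max_directed[OF ne bd bd]) (meson dir le_funD)
    finally show ?thesis .
  qed
  ultimately show ?thesis by (simp add: max_functional_def)
qed

text \<open>Zorn's lemma for the reversed pointwise order. Minimality below \<open>q\<close> is
  minimality among all such functionals, since anything below \<open>p\<close> is below
  \<open>q\<close>.\<close>

lemma max_functional_minimal:
  assumes q: "max_functional (q :: 'a::am_space \<Rightarrow> real)"
  obtains p where "max_functional p" "p \<le> q" "\<And>r. max_functional r \<Longrightarrow> r \<le> p \<Longrightarrow> r = p"
proof -
  let ?A = "{p. max_functional p \<and> p \<le> q}"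
  have "\<exists>m\<in>?A. \<forall>a\<in>?A. a \<le> m \<longrightarrow> a = m"
  proof (rule predicate_Zorn[where P = "\<lambda>p q. q \<le> p"])
    show "partial_order_on ?A (relation_of (\<lambda>p q. q \<le> p) ?A)"
      by (rule partial_order_on_relation_ofI) auto
    fix C assume "C \<in> Chains (relation_of (\<lambda>p q. q \<le> p) ?A)"
    then have C: "C \<subseteq> ?A" "\<And>p q. p \<in> C \<Longrightarrow> q \<in> C \<Longrightarrow> p \<le> q \<or> q \<le> p"
      by (auto simp: Chains_def relation_of_def)
    show "\<exists>u\<in>?A. \<forall>a\<in>C. u \<le> a"
    proof (cases "C = {}")
      case True then show ?thesis using q by auto
    next
      case False
      define u where "u x = (INF p\<in>C. p x)" for x
      have "max_functional u"
        unfolding u_def[abs_def] using False C by (intro max_functional_chain_INF) auto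
      moreover have bd: "bdd_below ((\<lambda>p. p x) ` C)" for x
        using max_functional_ge_norm C by (intro bdd_belowI2) auto
      have u: "u \<le> p" if "p \<in> C" for p
        unfolding u_def le_fun_def using cINF_lower[OF bd that] by blast
      moreover have "u \<le> q"
      proof -
        obtain p where "p \<in> C" using False by blast
        with u[OF this] C(1) show ?thesis by (auto intro: order_trans)
      qed
      ultimately show ?thesis by blast
    qed
  qed
  then obtain p where p: "max_functional p" "p \<le> q"
    and min: "\<And>r. max_functional r \<Longrightarrow> r \<le> q \<Longrightarrow> r \<le> p \<Longrightarrow> r = p" by auto
  show ?thesis
    by (rule that[OF p]) (rule min, auto intro: order_trans[OF _ p(2)])
qed

section \<open>Lattice states\<close>

text \<open>On C(K) these are the point evaluations. Linearity and the \<open>sup\<close> clause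
  also give preservation of \<open>inf\<close> and of absolute values.\<close>

definition lattice_states :: "('a::am_space \<Rightarrow> real) set" where
  "lattice_states = {\<phi>. (\<forall>x y. \<phi> (x + y) = \<phi> x + \<phi> y) \<and> (\<forall>c x. \<phi> (c *\<^sub>R x) = c * \<phi> x) \<and>
     (\<forall>x y. \<phi> (sup x y) = max (\<phi> x) (\<phi> y)) \<and> \<phi> \<e> = 1}"

lemma lattice_states_max_functional:
  assumes "\<phi> \<in> lattice_states" shows "max_functional \<phi>"
proof -
  have "\<phi> (x + y) = \<phi> x + \<phi> y" "\<phi> (c *\<^sub>R x) = c * \<phi> x" "\<phi> (sup x y) = max (\<phi> x) (\<phi> y)"
    "\<phi> \<e> = 1" for x y c
    using assms unfolding lattice_states_def by blast+
  then show ?thesis by (simp only: max_functional_def mult_1_right simp_thms order_refl)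
qed

lemma lattice_statesD:
  assumes "\<phi> \<in> lattice_states"
  shows "\<phi> (x + y) = \<phi> x + \<phi> y" "\<phi> (c *\<^sub>R x) = c * \<phi> x" "\<phi> (sup x y) = max (\<phi> x) (\<phi> y)"
    "\<phi> \<e> = 1" "\<phi> 0 = 0" "\<phi> (- x) = - \<phi> x" "\<phi> (x - y) = \<phi> x - \<phi> y"
    "\<phi> (inf x y) = min (\<phi> x) (\<phi> y)" "\<phi> \<bar>x\<bar> = \<bar>\<phi> x\<bar>"
    "x \<le> y \<Longrightarrow> \<phi> x \<le> \<phi> y" "\<bar>\<phi> x\<bar> \<le> norm x"
proof -
  note m = lattice_states_max_functional[OF assms]
  have add: "\<phi> (x + y) = \<phi> x + \<phi> y" and scale: "\<phi> (c *\<^sub>R x) = c * \<phi> x"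
    and sup: "\<phi> (sup x y) = max (\<phi> x) (\<phi> y)" and one: "\<phi> \<e> = 1" for x y c
    using assms by (auto simp: lattice_states_def)
  have minus: "\<phi> (- x) = - \<phi> x" for x using scale[of "-1" x] by simp
  show "\<phi> (x + y) = \<phi> x + \<phi> y" "\<phi> (c *\<^sub>R x) = c * \<phi> x" "\<phi> (sup x y) = max (\<phi> x) (\<phi> y)"
    "\<phi> \<e> = 1" "\<phi> (- x) = - \<phi> x" by (fact add scale sup one minus)+
  show "\<phi> 0 = 0" using m by (rule max_functional_zero)
  show "\<phi> (x - y) = \<phi> x - \<phi> y" using add[of x "- y"] minus by simp
  show "\<phi> (inf x y) = min (\<phi> x) (\<phi> y)"
    unfolding inf_eq_neg_sup[of x y] minus sup by linarith
  show "\<phi> \<bar>x\<bar> = \<bar>\<phi> x\<bar>" using m minus by (rule max_functional_abs_of_odd)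
  show "\<phi> x \<le> \<phi> y" if "x \<le> y" using m that by (rule max_functional_mono)
  show "\<bar>\<phi> x\<bar> \<le> norm x"
    using max_functional_le_norm[OF m, of x] max_functional_ge_norm[OF m, of x] by linarith
qed

text \<open>Oddness suffices, as it turns subadditivity and positive homogeneity into linearity. To
  obtain it, \<open>x\<close> is shifted to value 0; by minimality the restricted functional is
  \<open>p\<close> itself, which gives \<open>p (- x) \<le> - p x\<close>.\<close>

lemma minimal_max_functional_lattice_state:
  assumes p: "max_functional p" and min: "\<And>r. max_functional r \<Longrightarrow> r \<le> p \<Longrightarrow> r = p"
  shows "p \<in> lattice_states"
proof -
  have minus: "p (- x) = - p x" for x
  proof -
    have "p (x + (- p x) *\<^sub>R \<e>) = 0" using max_functional_translate[OF p, of x "- p x"] by simp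
    from max_functional_restrict[OF p this] min
    have "p (- (x + (- p x) *\<^sub>R \<e>)) \<le> 0" by blast
    then have "p (- x + p x *\<^sub>R \<e>) \<le> 0" by simp
    then have "p (- x) + p x \<le> 0" using max_functional_translate[OF p, of "- x" "p x"] by simp
    then show ?thesis using max_functional_minus[OF p, of x] by simp
  qed
  have "p (x + y) = p x + p y" for x y
    using max_functional_subadd[OF p, of x y] max_functional_subadd[OF p, of "- x" "- y"]
      minus[of "x + y"] by (simp add: minus)
  moreover have "p (c *\<^sub>R x) = c * p x" for c x
  proof (cases "0 \<le> c")
    case True then show ?thesis using p max_functional_scale_nonneg by blast
  next
    case False
    then have "p ((- c) *\<^sub>R x) = - c * p x" by (intro max_functional_scale_nonneg[OF p]) auto
    then show ?thesis using minus[of "c *\<^sub>R x"] by simp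
  qed
  moreover have "p \<e> = 1" using max_functional_unit[OF p, of 1] by simp
  ultimately show ?thesis using max_functional_sup[OF p] by (simp add: lattice_states_def)
qed

section \<open>The upper gauge and attainment of the norm\<close>

definition upper_gauge :: "'a::am_space \<Rightarrow> real" where
  "upper_gauge x = Inf {l. x \<le> l *\<^sub>R \<e>}"

lemma upper_gauge_set:
  fixes x :: "'a::am_space"
  shows "{l. x \<le> l *\<^sub>R \<e>} \<noteq> {}" "bdd_below {l. x \<le> l *\<^sub>R \<e>}"
proof -
  obtain m where m: "\<bar>x\<bar> \<le> m *\<^sub>R \<e>" using order_unit by blast
  then show "{l. x \<le> l *\<^sub>R \<e>} \<noteq> {}" using abs_ge_self order_trans by blast
  show "bdd_below {l. x \<le> l *\<^sub>R \<e>}"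
  proof (rule bdd_belowI)
    fix l assume "l \<in> {l. x \<le> l *\<^sub>R \<e>}"
    then have "(- m) *\<^sub>R \<e> \<le> l *\<^sub>R (\<e>::'a)"
      using m abs_ge_minus_self[of x] by simp (meson minus_le_iff order_trans)
    then show "- m \<le> l" by (simp only: order_unit_scale_le_iff)
  qed
qed

lemma upper_gauge_le: "x \<le> l *\<^sub>R \<e> \<Longrightarrow> upper_gauge x \<le> l"
  unfolding upper_gauge_def by (intro cInf_lower upper_gauge_set) simp

lemma upper_gauge_less:
  assumes "upper_gauge x < l" shows "x \<le> l *\<^sub>R \<e>"
proof -
  obtain m where "x \<le> m *\<^sub>R \<e>" "m < l"
    using assms cInf_lessD[OF upper_gauge_set(1)] unfolding upper_gauge_def by blast
  then show ?thesis using order_unit_scale_le_iff[of m l] order_trans by (metis less_imp_le)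
qed

text \<open>On C(K) this is the maximum over all of K. The equalities for translation and scaling
  come from one inequality, applied to the operation and to its inverse.\<close>

lemma max_functional_upper_gauge: "max_functional (upper_gauge :: 'a::am_space \<Rightarrow> real)"
proof -
  let ?p = "upper_gauge :: 'a \<Rightarrow> real"
  have le: "?p x \<le> c" if "\<And>l. c < l \<Longrightarrow> x \<le> l *\<^sub>R \<e>" for x c
    by (rule dense_ge) (use that upper_gauge_le in blast)
  have trans: "?p (x + c *\<^sub>R \<e>) \<le> ?p x + c" for x c
  proof (rule le)
    fix l assume "?p x + c < l"
    then have "x \<le> (l - c) *\<^sub>R \<e>" by (intro upper_gauge_less) simp
    then show "x + c *\<^sub>R \<e> \<le> l *\<^sub>R \<e>" by (simp add: algebra_simps le_diff_eq)
  qed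
  have "?p (x + c *\<^sub>R \<e>) = ?p x + c" for x c
    using trans[of x c] trans[of "x + c *\<^sub>R \<e>" "- c"] by simp
  moreover have scale: "?p (c *\<^sub>R x) \<le> c * ?p x" if "0 < c" for x c
  proof (rule le)
    fix l assume "c * ?p x < l"
    then have "x \<le> (l / c) *\<^sub>R \<e>"
      using that by (intro upper_gauge_less) (simp add: field_simps)
    then have "c *\<^sub>R x \<le> c *\<^sub>R ((l / c) *\<^sub>R \<e>)" using that by (intro scaleR_left_mono) auto
    then show "c *\<^sub>R x \<le> l *\<^sub>R \<e>" using that by simp
  qed
  have "?p (c *\<^sub>R x) = c * ?p x" if "0 < c" for x c
    using scale[OF that, of x] scale[of "1 / c" "c *\<^sub>R x"] that
    by (simp add: pos_le_divide_eq mult.commute)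
  moreover have "?p (x + y) \<le> ?p x + ?p y" for x y
  proof (rule le)
    fix l assume "?p x + ?p y < l"
    \<comment> \<open>The slack \<open>l - ?p x - ?p y\<close> is halved, so each coefficient
      strictly exceeds the gauge of its summand.\<close>
    then have "x + y \<le> ((l + ?p x - ?p y) / 2) *\<^sub>R \<e> + ((l - ?p x + ?p y) / 2) *\<^sub>R \<e>"
      by (intro add_mono upper_gauge_less) (auto simp: field_simps)
    also have "\<dots> = l *\<^sub>R \<e>" unfolding scaleR_add_left[symmetric] by (simp add: field_simps)
    finally show "x + y \<le> l *\<^sub>R \<e>" .
  qed
  moreover have "?p (sup x y) = max (?p x) (?p y)" for x y
  proof (rule antisym)
    show "?p (sup x y) \<le> max (?p x) (?p y)"
      by (rule le) (simp add: upper_gauge_less)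
    have "?p a \<le> ?p b" if "a \<le> b" for a b
      by (rule le) (meson that upper_gauge_less order_trans)
    then show "max (?p x) (?p y) \<le> ?p (sup x y)" by simp
  qed
  ultimately show ?thesis unfolding max_functional_def by blast
qed

text \<open>The norm admits only positive \<open>l\<close>, the gauge every real \<open>l\<close>;
  nonnegativity of the gauge at \<open>\<bar>x\<bar>\<close> removes the difference.\<close>

lemma upper_gauge_abs: "upper_gauge \<bar>x\<bar> = norm (x :: 'a::am_space)"
proof (rule antisym)
  show "upper_gauge \<bar>x\<bar> \<le> norm x"
    unfolding norm_order_unit
    by (rule cInf_greatest) (use order_unit[of x] upper_gauge_le in auto)
  have bd: "bdd_below {l. 0 < l \<and> \<bar>x\<bar> \<le> l *\<^sub>R \<e>}" by (rule bdd_belowI[of _ 0]) auto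
  have "0 \<le> upper_gauge \<bar>x\<bar>"
    using max_functional_mono[OF max_functional_upper_gauge, of 0 "\<bar>x\<bar>"]
      max_functional_zero[OF max_functional_upper_gauge, where 'a='a] by simp
  show "norm x \<le> upper_gauge \<bar>x\<bar>"
    unfolding norm_order_unit
    by (rule dense_ge, rule cInf_lower[OF _ bd])
       (use \<open>0 \<le> upper_gauge \<bar>x\<bar>\<close> upper_gauge_less in auto)
qed

text \<open>In the model, the gauge is restricted to the points where \<open>\<bar>x\<bar>\<close>
  reaches its maximum, and a minimal functional below the restriction is evaluation at such a
  point.\<close>

lemma lattice_states_norming:
  obtains \<phi> where "\<phi> \<in> lattice_states" "\<bar>\<phi> x\<bar> = norm (x::'a::am_space)"
proof -
  note g = max_functional_upper_gauge
  have "upper_gauge (\<bar>x\<bar> + (- norm x) *\<^sub>R \<e>) = 0"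
    using max_functional_translate[OF g, of "\<bar>x\<bar>" "- norm x"] by (simp add: upper_gauge_abs)
  from max_functional_restrict[OF g this] obtain q where
    q: "max_functional q" "q (- (\<bar>x\<bar> + (- norm x) *\<^sub>R \<e>)) \<le> 0" by blast
  obtain \<phi> where phi: "max_functional \<phi>" "\<phi> \<le> q" "\<And>r. max_functional r \<Longrightarrow> r \<le> \<phi> \<Longrightarrow> r = \<phi>"
    using max_functional_minimal[OF q(1)] by blast
  then have s: "\<phi> \<in> lattice_states" using minimal_max_functional_lattice_state by blast
  have "\<phi> (- (\<bar>x\<bar> + (- norm x) *\<^sub>R \<e>)) \<le> 0" using q(2) phi(2) le_funD order_trans by metis
  then have "norm x \<le> \<bar>\<phi> x\<bar>"
    by (simp only: lattice_statesD[OF s])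
  then show ?thesis using that[OF s] lattice_statesD(11)[OF s, of x] by simp
qed

text \<open>The kernel of a state is an algebra ideal, because
  \<open>0 \<le> x * y \<le> l *\<^sub>R x\<close> for positive \<open>x\<close>, \<open>y\<close>
  with \<open>y \<le> l *\<^sub>R \<e>\<close>. Multiplicativity follows as
  \<open>x - \<phi> x *\<^sub>R \<e>\<close> lies in the kernel.\<close>

lemma lattice_states_mult:
  fixes x y :: "'a::am_algebra"
  assumes s: "\<phi> \<in> lattice_states"
  shows "\<phi> (x * y) = \<phi> x * \<phi> y"
proof -
  note D = lattice_statesD[OF s]
  have pos: "\<phi> (x * y) = 0" if "0 \<le> x" "0 \<le> y" "\<phi> x = 0" for x y
  proof -
    obtain l where l: "\<bar>y\<bar> \<le> l *\<^sub>R \<e>" using order_unit[of y] by blast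
    have "0 \<le> x * (l *\<^sub>R \<e> - y)"
      using that(1) order_trans[OF abs_ge_self l] by (intro mult_nonneg) simp_all
    then have "x * y \<le> l *\<^sub>R x" by (simp add: algebra_simps order_unit_eq_one)
    then have "\<phi> (x * y) \<le> 0" using D(10)[of "x * y" "l *\<^sub>R x"] D(2) that by simp
    moreover have "0 \<le> \<phi> (x * y)" using D(10)[OF mult_nonneg[OF that(1,2)]] D(5) by simp
    ultimately show ?thesis by simp
  qed
  have ker: "\<phi> (u * y) = 0" if u: "\<phi> u = 0" for u
  proof -
    \<comment> \<open>A state preserves \<open>sup\<close>, so the positive and negative parts of
      \<open>u\<close> stay in the kernel and only positive factors remain.\<close>
    define a b c d where "a = sup u 0" "b = sup (- u) 0" "c = sup y 0" "d = sup (- y) 0"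
    have split: "v = sup v 0 - sup (- v) 0" for v :: 'a
      using prts[of v] pprt_neg[of v] by (simp add: pprt_def)
    have "u * y = (a - b) * (c - d)"
      using split[of u] split[of y] by (simp only: a_b_c_d_def)
    also have "\<dots> = a * c - a * d - (b * c - b * d)" by (simp add: algebra_simps)
    finally have "u * y = a * c - a * d - (b * c - b * d)" .
    moreover have "\<phi> a = 0" "\<phi> b = 0" "0 \<le> a" "0 \<le> b" "0 \<le> c" "0 \<le> d"
      using u by (simp_all add: D a_b_c_d_def)
    ultimately show ?thesis by (simp add: D pos)
  qed
  have "\<phi> ((x - \<phi> x *\<^sub>R \<e>) * y) = 0" by (rule ker) (simp add: D)
  then show ?thesis by (simp add: D algebra_simps order_unit_eq_one)
qed

section \<open>Representation on the space of lattice states\<close>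

text \<open>The norm bound confines each coordinate to a compact interval, so Tychonoff's theorem
  applies; the defining equations are closed under pointwise limits.\<close>

lemma compact_lattice_states: "compact (lattice_states :: ('a::am_space \<Rightarrow> real) set)"
proof -
  let ?B = "PiE UNIV (\<lambda>x::'a. {- norm x..norm x})"
  have "compactin (product_topology (\<lambda>i. euclidean) UNIV) ?B"
    by (subst compactin_PiE) (auto simp flip: atLeastAtMost_def)
  then have "compact ?B" by (simp add: euclidean_product_topology)
  moreover have "closed (lattice_states :: ('a \<Rightarrow> real) set)"
    unfolding lattice_states_def
    by (intro closed_Collect_conj closed_Collect_all closed_Collect_eq continuous_intros
        continuous_on_product_coordinates)
  moreover have "lattice_states \<subseteq> ?B"
  proof
    fix \<phi> :: "'a \<Rightarrow> real" assume "\<phi> \<in> lattice_states"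
    from lattice_statesD(11)[OF this] show "\<phi> \<in> ?B" by (simp add: PiE_iff abs_le_iff minus_le_iff)
  qed
  ultimately show ?thesis by (metis compact_Int_closed inf.absorb_iff2)
qed

section \<open>The lattice states as a compact Hausdorff space\<close>

typedef (overloaded) 'a lattice_state = "lattice_states :: ('a::am_space \<Rightarrow> real) set"
  using lattice_states_norming by blast

text \<open>The function type itself is not an instance of \<^class>\<open>t2_space\<close>, hence the subtype.\<close>

instantiation lattice_state :: (am_space) t2_space
begin

definition open_lattice_state :: "'a lattice_state set \<Rightarrow> bool" where
  "open_lattice_state U \<longleftrightarrow> (\<exists>V. open V \<and> U = Rep_lattice_state -` V)"

instance
proof
  show "open (UNIV :: 'a lattice_state set)"
    unfolding open_lattice_state_def by (intro exI[of _ UNIV]) auto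
  show "open (S \<inter> T)" if "open S" "open T" for S T :: "'a lattice_state set"
    using that unfolding open_lattice_state_def by (metis open_Int vimage_Int)
  show "open (\<Union>K)" if "\<forall>S\<in>K. open S" for K :: "'a lattice_state set set"
  proof -
    from that obtain V where V: "\<And>S. S \<in> K \<Longrightarrow> open (V S) \<and> S = Rep_lattice_state -` V S"
      unfolding open_lattice_state_def by metis
    then have "\<Union>K = Rep_lattice_state -` (\<Union>S\<in>K. V S)" by blast
    moreover have "open (\<Union>S\<in>K. V S)" using V by auto
    ultimately show ?thesis unfolding open_lattice_state_def by blast
  qed
  fix \<phi> \<psi> :: "'a lattice_state" assume "\<phi> \<noteq> \<psi>"
  then obtain x where "Rep_lattice_state \<phi> x \<noteq> Rep_lattice_state \<psi> x"
    by (meson Rep_lattice_state_inject ext)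
  then obtain U V where UV: "open U" "open V" "Rep_lattice_state \<phi> x \<in> U"
    "Rep_lattice_state \<psi> x \<in> V" "U \<inter> V = {}" by (meson hausdorff)
  have op: "open ((\<lambda>f. f x) -` W)" if "open W" for W :: "real set"
    using that by (rule open_vimage) (rule continuous_on_product_coordinates)
  have op': "open (Rep_lattice_state -` ((\<lambda>f. f x) -` W))" if "open W" for W :: "real set"
    using op[OF that] by (auto simp: open_lattice_state_def)
  show "\<exists>U V. open U \<and> open V \<and> \<phi> \<in> U \<and> \<psi> \<in> V \<and> U \<inter> V = {}"
    by (rule exI[of _ "Rep_lattice_state -` ((\<lambda>f. f x) -` U)"],
        rule exI[of _ "Rep_lattice_state -` ((\<lambda>f. f x) -` V)"])
       (use UV op' in auto)
qed

end

lemma continuous_Rep_lattice_state: "continuous_on UNIV Rep_lattice_state"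
  unfolding continuous_on_open_vimage[OF open_UNIV] by (auto simp: open_lattice_state_def)

lemma compact_UNIV_lattice_state: "compact (UNIV :: 'a::am_space lattice_state set)"
proof -
  have "continuous_on lattice_states (Abs_lattice_state :: ('a \<Rightarrow> real) \<Rightarrow> _)"
    unfolding continuous_on_open_invariant open_lattice_state_def
    by (auto simp: Abs_lattice_state_inverse)
  from compact_continuous_image[OF this compact_lattice_states]
  show ?thesis by (simp add: type_definition.Abs_image[OF type_definition_lattice_state])
qed

text \<open>Evaluations form an algebra because states are multiplicative, contain the constants
  through multiples of \<open>\<e>\<close>, and separate points, so the Stone-Weierstrass theorem
  applies.\<close>

lemma lattice_states_dense:
  fixes f :: "('a::am_algebra \<Rightarrow> real) \<Rightarrow> real"
  assumes f: "continuous_on lattice_states f" and "0 < e"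
  obtains x where "\<And>\<phi>. \<phi> \<in> lattice_states \<Longrightarrow> \<bar>f \<phi> - \<phi> x\<bar> < e"
proof -
  let ?R = "range (\<lambda>x::'a. \<lambda>\<phi>. Rep_lattice_state \<phi> x)"
  note D = lattice_statesD[OF Rep_lattice_state]
  interpret function_ring_on ?R UNIV
  proof
    show "compact (UNIV :: 'a lattice_state set)" by (rule compact_UNIV_lattice_state)
    show "continuous_on UNIV g" if "g \<in> ?R" for g
      using that continuous_on_product_then_coordinatewise[OF continuous_Rep_lattice_state] by auto
    show "(\<lambda>\<phi>. g \<phi> + h \<phi>) \<in> ?R" if gh: "g \<in> ?R" "h \<in> ?R" for g h
    proof -
      obtain x y where "g = (\<lambda>\<phi>. Rep_lattice_state \<phi> x)" "h = (\<lambda>\<phi>. Rep_lattice_state \<phi> y)"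
        using gh by blast
      then show ?thesis by (intro range_eqI[of _ _ "x + y"]) (simp add: D)
    qed
    show "(\<lambda>\<phi>. g \<phi> * h \<phi>) \<in> ?R" if gh: "g \<in> ?R" "h \<in> ?R" for g h
    proof -
      obtain x y where "g = (\<lambda>\<phi>. Rep_lattice_state \<phi> x)" "h = (\<lambda>\<phi>. Rep_lattice_state \<phi> y)"
        using gh by blast
      then show ?thesis by (intro range_eqI[of _ _ "x * y"]) (simp add: lattice_states_mult[OF Rep_lattice_state])
    qed
    show "(\<lambda>_. c) \<in> ?R" for c
      by (rule range_eqI[of _ _ "c *\<^sub>R \<e>"]) (simp add: D)
    show "\<exists>f\<in>?R. f \<phi> \<noteq> f \<psi>" if "\<phi> \<noteq> \<psi>" for \<phi> \<psi>
      using that by (auto simp: Rep_lattice_state_inject[symmetric] fun_eq_iff)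
  qed
  have "continuous_on UNIV (\<lambda>\<phi>. f (Rep_lattice_state \<phi>))"
    by (rule continuous_on_compose2[OF f continuous_Rep_lattice_state]) (auto simp: Rep_lattice_state)
  from Stone_Weierstrass_basic[OF this \<open>0 < e\<close>]
  obtain x where "\<And>\<phi>. \<bar>f (Rep_lattice_state \<phi>) - Rep_lattice_state \<phi> x\<bar> < e" by auto
  then show ?thesis by (intro that[of x]) (auto elim: Rep_lattice_state_cases)
qed

text \<open>Uniform approximants are Cauchy in V, because some state attains the norm of each
  difference. Completeness gives a limit, which represents \<open>f\<close> since states are norm
  continuous.\<close>

lemma lattice_states_onto:
  fixes f :: "('a::am_algebra \<Rightarrow> real) \<Rightarrow> real"
  assumes f: "continuous_on lattice_states f"
  obtains x where "\<And>\<phi>. \<phi> \<in> lattice_states \<Longrightarrow> \<phi> x = f \<phi>"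
proof -
  have "\<forall>n::nat. \<exists>x. \<forall>\<phi>\<in>lattice_states. \<bar>f \<phi> - \<phi> x\<bar> < inverse (Suc n)"
  proof
    fix n :: nat
    show "\<exists>x. \<forall>\<phi>\<in>lattice_states. \<bar>f \<phi> - \<phi> x\<bar> < inverse (Suc n)"
      by (rule lattice_states_dense[OF f, of "inverse (Suc n)"]) auto
  qed
  then obtain X where X: "\<And>n \<phi>. \<phi> \<in> lattice_states \<Longrightarrow> \<bar>f \<phi> - \<phi> (X n)\<bar> < inverse (Suc n)"
    by metis
  have dist: "dist (X m) (X n) < inverse (Suc m) + inverse (Suc n)" for m n
  proof -
    obtain \<phi> where s: "\<phi> \<in> lattice_states" "\<bar>\<phi> (X m - X n)\<bar> = norm (X m - X n)"
      using lattice_states_norming by blast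
    then show ?thesis
      using X[OF s(1), of m] X[OF s(1), of n] by (simp add: lattice_statesD[OF s(1)] dist_norm)
  qed
  have "Cauchy X"
  proof (rule metric_CauchyI)
    fix e :: real assume "0 < e"
    then obtain N where N: "inverse (real (Suc N)) < e / 2" using reals_Archimedean half_gt_zero by blast
    show "\<exists>M. \<forall>m\<ge>M. \<forall>n\<ge>M. dist (X m) (X n) < e"
    proof (intro exI[of _ N] allI impI)
      fix m n assume "N \<le> m" "N \<le> n"
      then have "inverse (real (Suc m)) \<le> inverse (real (Suc N))" "inverse (real (Suc n)) \<le> inverse (real (Suc N))"
        by (auto intro!: le_imp_inverse_le)
      with dist[of m n] N show "dist (X m) (X n) < e" by linarith
    qed
  qed
  then obtain x where x: "X \<longlonglongrightarrow> x" using Cauchy_convergent convergent_def by blast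
  have "\<phi> x = f \<phi>" if s: "\<phi> \<in> lattice_states" for \<phi>
  proof (rule LIMSEQ_unique)
    have "\<bar>\<phi> (X n) - \<phi> x\<bar> \<le> norm (X n - x)" for n
      using lattice_statesD(11)[OF s, of "X n - x"] by (simp add: lattice_statesD[OF s])
    moreover have "(\<lambda>n. norm (X n - x)) \<longlonglongrightarrow> 0" using x by (simp add: LIM_zero tendsto_norm_zero)
    ultimately have "(\<lambda>n. \<phi> (X n) - \<phi> x) \<longlonglongrightarrow> 0"
      by - (rule Lim_null_comparison[OF always_eventually, rotated], assumption, simp)
    then show "(\<lambda>n. \<phi> (X n)) \<longlonglongrightarrow> \<phi> x" by (rule LIM_zero_cancel)
    show "(\<lambda>n. \<phi> (X n)) \<longlonglongrightarrow> f \<phi>"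
    proof (rule LIM_zero_cancel, rule Lim_null_comparison)
      show "\<forall>\<^sub>F n in sequentially. norm (\<phi> (X n) - f \<phi>) \<le> inverse (real (Suc n))"
        using X[OF s] by (intro always_eventually allI) (simp add: abs_minus_commute less_imp_le)
      show "(\<lambda>n. inverse (real (Suc n))) \<longlonglongrightarrow> 0" by (rule LIMSEQ_inverse_real_of_nat)
    qed
  qed
  then show ?thesis using that by blast
qed

lemma am_representation_lattice_states:
  "am_representation (top_of_set lattice_states)
     (\<lambda>x::'a::am_algebra. \<lambda>\<phi>\<in>lattice_states. \<phi> x)"
  unfolding am_representation_def topspace_euclidean_subtopology
proof (intro conjI allI)
  let ?K = "lattice_states :: ('a \<Rightarrow> real) set"
  let ?\<Phi> = "\<lambda>x::'a. \<lambda>\<phi>\<in>?K. \<phi> x"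
  show "compact_space (top_of_set ?K)"
    by (intro compact_space_subtopology) (simp add: compact_lattice_states)
  have "Hausdorff_space (euclidean :: ('a \<Rightarrow> real) topology)"
    by (simp add: Hausdorff_space_product_topology flip: euclidean_product_topology)
  then show "Hausdorff_space (top_of_set ?K)" by (rule Hausdorff_space_subtopology)
  show "range ?\<Phi> = continuous_functions (top_of_set ?K)"
  proof (intro equalityI subsetI)
    fix g assume "g \<in> range ?\<Phi>"
    then obtain x where g: "g = ?\<Phi> x" by blast
    have "continuous_on ?K (\<lambda>\<phi>. \<phi> x)"
      by (rule continuous_on_subset[OF continuous_on_product_coordinates]) simp
    then have "continuous_on ?K g" using g by (simp cong: continuous_on_cong)
    then show "g \<in> continuous_functions (top_of_set ?K)" by (simp add: continuous_functions_def g)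
  next
    fix g assume "g \<in> continuous_functions (top_of_set ?K)"
    then have g: "g \<in> extensional ?K" "continuous_on ?K g" by (auto simp: continuous_functions_def)
    then obtain x where "\<And>\<phi>. \<phi> \<in> ?K \<Longrightarrow> \<phi> x = g \<phi>" using lattice_states_onto by blast
    then have "g = ?\<Phi> x" using g(1) by (intro extensionalityI[of _ ?K]) auto
    then show "g \<in> range ?\<Phi>" by blast
  qed
  fix x :: 'a
  obtain \<phi> where "\<phi> \<in> ?K" "\<bar>\<phi> x\<bar> = norm x" using lattice_states_norming by blast
  then have "(SUP \<phi>\<in>?K. \<bar>\<phi> x\<bar>) = norm x"
    using lattice_statesD(11) by (intro cSup_eq_maximum) (auto intro: rev_image_eqI)
  then show "norm x = (SUP \<phi>\<in>?K. \<bar>?\<Phi> x \<phi>\<bar>)" by simp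
qed (auto simp: lattice_statesD lattice_states_mult intro!: restrict_ext)

text \<open>The choice succeeds because one representation exists. The chosen pair need not be the
  one just built, so only the defining properties are available from here on.\<close>

lemma am_representation_am_rep:
  "am_representation (fst (am_rep :: _ \<times> ('a::am_algebra \<Rightarrow> _))) (snd (am_rep :: _ \<times> ('a \<Rightarrow> _)))"
proof -
  have "\<exists>r::(('a \<Rightarrow> real) topology \<times> ('a \<Rightarrow> ('a \<Rightarrow> real) \<Rightarrow> real)). case r of (K, \<Phi>) \<Rightarrow> am_representation K \<Phi>"
    using am_representation_lattice_states by (intro exI) (rule case_prodI)
  from someI_ex[OF this] show ?thesis by (simp add: am_rep_def case_prod_unfold)
qed

section \<open>Functional calculus\<close>

definition spectrum :: "('a::am_algebra \<Rightarrow> real) set" where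
  "spectrum = topspace (fst am_rep)"

definition gelfand :: "'a::am_algebra \<Rightarrow> ('a \<Rightarrow> real) \<Rightarrow> real" where
  "gelfand = snd am_rep"

lemma am_representation_gelfand:
  "am_representation (fst (am_rep :: _ \<times> ('a::am_algebra \<Rightarrow> _))) (gelfand :: 'a \<Rightarrow> _)"
  unfolding gelfand_def by (rule am_representation_am_rep)

lemma compact_spectrum: "compact_space (fst (am_rep :: _ \<times> ('a::am_algebra \<Rightarrow> _)))"
  and range_gelfand: "range (gelfand :: 'a \<Rightarrow> _) = continuous_functions (fst am_rep)"
  and gelfand_add_fun: "\<forall>x y::'a. gelfand (x + y) = (\<lambda>k\<in>spectrum. gelfand x k + gelfand y k)"
  and gelfand_scaleR_fun: "\<forall>c. \<forall>x::'a. gelfand (c *\<^sub>R x) = (\<lambda>k\<in>spectrum. c * gelfand x k)"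
  and gelfand_mult_fun: "\<forall>x y::'a. gelfand (x * y) = (\<lambda>k\<in>spectrum. gelfand x k * gelfand y k)"
  and gelfand_sup_fun: "\<forall>x y::'a. gelfand (sup x y) = (\<lambda>k\<in>spectrum. max (gelfand x k) (gelfand y k))"
  and gelfand_unit_fun: "gelfand (\<e>::'a) = (\<lambda>k\<in>spectrum. 1)"
  and norm_gelfand: "\<forall>x::'a. norm x = (SUP k\<in>spectrum. \<bar>gelfand x k\<bar>)"
  unfolding spectrum_def
  by (insert am_representation_gelfand[where 'a='a, unfolded am_representation_def], elim conjE, assumption)+

lemma
  assumes "k \<in> spectrum"
  shows gelfand_add: "gelfand (x + y) k = gelfand x k + gelfand y k"
    and gelfand_scaleR: "gelfand (c *\<^sub>R x) k = c * gelfand x k"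
    and gelfand_mult: "gelfand (x * y) k = gelfand x k * gelfand y k"
    and gelfand_sup: "gelfand (sup x y) k = max (gelfand x k) (gelfand y k)"
    and gelfand_unit: "gelfand \<e> k = 1"
  using assms
  by (simp_all add: gelfand_add_fun gelfand_scaleR_fun gelfand_mult_fun gelfand_sup_fun gelfand_unit_fun)

lemma gelfand_diff: "k \<in> spectrum \<Longrightarrow> gelfand (x - y) k = gelfand x k - gelfand y k"
  using gelfand_add[of k "x - y" y] by simp

lemma gelfand_zero: "k \<in> spectrum \<Longrightarrow> gelfand 0 k = 0"
  using gelfand_diff[of k 0 0] by simp

lemma spectrum_nonempty: "(spectrum :: ('a::am_algebra \<Rightarrow> real) set) \<noteq> {}"
proof
  assume "(spectrum :: ('a \<Rightarrow> real) set) = {}"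
  \<comment> \<open>For empty K the norm formula takes the supremum of the same empty set for every
    element, although 1 and 0 have different norms.\<close>
  then have "norm (1::'a) = norm (0::'a)" by (simp only: norm_gelfand image_empty)
  then show False by simp
qed

text \<open>Injectivity of the representation, read off from the norm formula for
  \<open>x - y\<close>.\<close>

lemma gelfand_eqI:
  fixes x y :: "'a::am_algebra"
  assumes "\<And>k. k \<in> spectrum \<Longrightarrow> gelfand x k = gelfand y k"
  shows "x = y"
proof -
  have "norm (x - y) = (SUP k\<in>(spectrum :: ('a \<Rightarrow> real) set). 0)"
    by (subst norm_gelfand[rule_format], rule SUP_cong) (simp_all add: gelfand_diff assms)
  also have "\<dots> = 0" by (rule cSUP_const[OF spectrum_nonempty])
  finally show ?thesis by simp
qed

text \<open>The order is encoded by \<open>sup x y = y\<close>, which an injective lattice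
  homomorphism preserves and reflects.\<close>

lemma le_iff_gelfand:
  fixes x y :: "'a::am_algebra"
  shows "x \<le> y \<longleftrightarrow> (\<forall>k\<in>spectrum. gelfand x k \<le> gelfand y k)"
proof
  assume "x \<le> y"
  then have "sup x y = y" by (rule sup_absorb2)
  then show "\<forall>k\<in>spectrum. gelfand x k \<le> gelfand y k"
    using gelfand_sup[of _ x y] by (metis max.cobounded1)
next
  assume "\<forall>k\<in>spectrum. gelfand x k \<le> gelfand y k"
  then have "sup x y = y" by (intro gelfand_eqI) (simp add: gelfand_sup)
  then show "x \<le> y" by (metis sup_ge1)
qed

lemma continuous_gelfand: "continuous_map (fst am_rep) euclideanreal (gelfand x)"
  using range_gelfand by (auto simp: continuous_functions_def)

text \<open>The composite of \<open>g\<close> with \<open>gelfand x\<close> is continuous on K, so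
  surjectivity makes the inverse in \<open>am_apply\<close> a true preimage. The set
  \<open>S\<close> covers \<open>ln\<close> and powers on positive values.\<close>

lemma gelfand_am_apply:
  assumes g: "continuous_on S g" and S: "\<And>k. k \<in> spectrum \<Longrightarrow> gelfand x k \<in> S"
    and k: "k \<in> spectrum"
  shows "gelfand (am_apply g x) k = g (gelfand x k)"
proof -
  let ?f = "\<lambda>k\<in>spectrum. g (gelfand x k)"
  have "continuous_map (fst am_rep) (top_of_set S) (gelfand x)"
    using S by (auto simp: continuous_map_in_subtopology continuous_gelfand spectrum_def)
  from continuous_map_compose[OF this, of euclideanreal g]
  have "continuous_map (fst am_rep) euclideanreal (g \<circ> gelfand x)"
    using g by (simp add: continuous_map_iff_continuous)
  then have "continuous_map (fst am_rep) euclideanreal ?f"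
    by (rule continuous_map_eq) (simp add: spectrum_def)
  then have "?f \<in> range gelfand"
    unfolding range_gelfand continuous_functions_def by (simp add: spectrum_def)
  then have "gelfand (inv gelfand ?f) = ?f" by (rule f_inv_into_f)
  moreover have "am_apply g x = inv gelfand ?f"
    by (simp add: am_apply_def case_prod_unfold gelfand_def spectrum_def)
  ultimately show ?thesis using k by simp
qed

text \<open>An interior point stays in the cone after subtracting a small multiple of
  \<open>\<e>\<close>. Conversely, compactness of K gives a positive minimum, and the ball of that
  radius lies in the cone.\<close>

lemma interior_positive_cone_iff:
  fixes x :: "'a::am_algebra"
  shows "x \<in> interior positive_cone \<longleftrightarrow> (\<forall>k\<in>spectrum. 0 < gelfand x k)"
proof
  assume "x \<in> interior positive_cone"
  then obtain e where e: "0 < e" "ball x e \<subseteq> positive_cone" by (meson mem_interior)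
  have "dist x (x - (e / 2) *\<^sub>R \<e>) = e / 2" using e(1) by (simp add: dist_norm order_unit_eq_one)
  then have "x - (e / 2) *\<^sub>R \<e> \<in> ball x e" using e(1) by simp
  then have "0 \<le> x - (e / 2) *\<^sub>R \<e>" using e(2) by blast
  then have "(e / 2) *\<^sub>R \<e> \<le> x" by simp
  then show "\<forall>k\<in>spectrum. 0 < gelfand x k"
    using e(1) by (fastforce simp: le_iff_gelfand gelfand_scaleR gelfand_unit)
next
  assume pos: "\<forall>k\<in>spectrum. 0 < gelfand x k"
  have "compactin euclideanreal (gelfand x ` topspace (fst am_rep))"
    by (rule image_compactin[OF compact_spectrum[unfolded compact_space_def] continuous_gelfand])
  then have "compact (gelfand x ` spectrum)" by (simp add: spectrum_def)
  then obtain k where k: "k \<in> spectrum" "\<And>j. j \<in> spectrum \<Longrightarrow> gelfand x k \<le> gelfand x j"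
    using compact_attains_inf[of "gelfand x ` spectrum"] spectrum_nonempty by auto
  define d where "d = gelfand x k"
  have "0 \<le> y" if "y \<in> ball x d" for y
  proof -
    \<comment> \<open>Distance below \<open>d\<close> becomes an order inequality: \<open>y\<close>
      falls below \<open>x\<close> by at most the minimum of \<open>x\<close>.\<close>
    have "upper_gauge \<bar>x - y\<bar> < d" using that by (simp add: upper_gauge_abs dist_norm)
    from order_trans[OF abs_ge_self upper_gauge_less[OF this]] have "x - y \<le> d *\<^sub>R \<e>" .
    then have "gelfand x j - gelfand y j \<le> d" if "j \<in> spectrum" for j
      using that by (simp add: le_iff_gelfand gelfand_scaleR gelfand_unit gelfand_diff)
    then show ?thesis using k(2) by (fastforce simp: le_iff_gelfand gelfand_zero d_def)
  qed
  moreover have "0 < d" using pos k(1) by (simp add: d_def)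
  ultimately show "x \<in> interior positive_cone" by (auto simp: mem_interior)
qed

section \<open>The exponential map and its image\<close>

lemma gelfand_am_exp: "k \<in> spectrum \<Longrightarrow> gelfand (am_exp x) k = exp (gelfand x k)"
  unfolding am_exp_def by (rule gelfand_am_apply[of UNIV]) (auto intro: continuous_intros)

lemma inj_am_exp: "inj (am_exp :: 'a::am_algebra \<Rightarrow> 'a)"
proof (rule injI)
  fix x y :: 'a assume eq: "am_exp x = am_exp y"
  have "gelfand x k = gelfand y k" if "k \<in> spectrum" for k
    using gelfand_am_exp[OF that, of x] gelfand_am_exp[OF that, of y] eq by simp
  then show "x = y" by (rule gelfand_eqI)
qed

lemma range_am_exp: "range (am_exp :: 'a::am_algebra \<Rightarrow> 'a) = interior positive_cone"
proof (intro equalityI subsetI)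
  fix x :: 'a assume "x \<in> range am_exp"
  then show "x \<in> interior positive_cone"
    by (auto simp: interior_positive_cone_iff gelfand_am_exp)
next
  fix x :: 'a assume "x \<in> interior positive_cone"
  then have pos: "\<And>k. k \<in> spectrum \<Longrightarrow> 0 < gelfand x k" by (simp add: interior_positive_cone_iff)
  have "continuous_on {0<..} (ln :: real \<Rightarrow> real)" by (intro continuous_intros) auto
  then have "gelfand (am_apply ln x) k = ln (gelfand x k)" if "k \<in> spectrum" for k
    using pos that by (intro gelfand_am_apply[of "{0<..}"]) auto
  \<comment> \<open>The preimage is the logarithm from the functional calculus, available as
    \<open>x\<close> takes only positive values on K.\<close>
  then have "x = am_exp (am_apply ln x)"
    using pos by (intro gelfand_eqI) (simp add: gelfand_am_exp)
  then show "x \<in> range am_exp" by blast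
qed

lemma am_exp_le_iff: "am_exp x \<le> am_exp y \<longleftrightarrow> x \<le> y"
  by (simp add: le_iff_gelfand gelfand_am_exp)

lemma am_exp_translate: "am_exp (x + c *\<^sub>R \<e>) = exp c *\<^sub>R am_exp x"
  by (rule gelfand_eqI)
     (simp add: gelfand_am_exp gelfand_add gelfand_scaleR gelfand_unit exp_add)

text \<open>Pointwise, \<open>exp a powr s\<close> is \<open>exp (s * a)\<close>. With
  \<open>t = 1 - s\<close> convex combinations become geometric ones.\<close>

lemma am_exp_combination:
  "am_exp (s *\<^sub>R x + t *\<^sub>R y) = am_powr (am_exp x) s * am_powr (am_exp y) t"
proof (rule gelfand_eqI)
  fix k :: "'a \<Rightarrow> real" assume k: "k \<in> spectrum"
  have powr: "gelfand (am_powr (am_exp z) r) k = exp (r * gelfand z k)" for z :: 'a and r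
  proof -
    have "continuous_on {0<..} (\<lambda>s::real. if r = 0 then 1 else s powr r)"
      by (cases "r = 0") (auto intro!: continuous_intros)
    then have "gelfand (am_powr (am_exp z) r) k =
        (if r = 0 then 1 else gelfand (am_exp z) k powr r)"
      unfolding am_powr_def using k
      by (intro gelfand_am_apply[of "{0<..}"]) (auto simp: gelfand_am_exp)
    then show ?thesis using k by (simp add: gelfand_am_exp powr_def)
  qed
  show "gelfand (am_exp (s *\<^sub>R x + t *\<^sub>R y)) k = gelfand (am_powr (am_exp x) s * am_powr (am_exp y) t) k"
    using k by (simp add: gelfand_am_exp gelfand_add gelfand_scaleR gelfand_mult powr exp_add)
qed

section \<open>The transported topology\<close>

lemma openin_exp_topology:
  "openin (exp_topology \<tau>) W \<longleftrightarrow> (\<exists>U. openin \<tau> U \<and> W = am_exp ` U)"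
proof -
  \<comment> \<open>Injectivity of \<open>am_exp\<close> makes images commute with
    intersections.\<close>
  have "istopology (\<lambda>W. \<exists>U. openin \<tau> U \<and> W = am_exp ` U)"
    unfolding istopology_def
  proof (intro conjI allI impI)
    fix S T assume "\<exists>U. openin \<tau> U \<and> S = am_exp ` U" "\<exists>U. openin \<tau> U \<and> T = am_exp ` U"
    then show "\<exists>U. openin \<tau> U \<and> S \<inter> T = am_exp ` U"
      by (metis image_Int inj_am_exp openin_Int)
  next
    fix \<K> assume "\<forall>W\<in>\<K>. \<exists>U. openin \<tau> U \<and> W = am_exp ` U"
    then obtain U where "\<And>W. W \<in> \<K> \<Longrightarrow> openin \<tau> (U W) \<and> W = am_exp ` U W" by metis
    then have "openin \<tau> (\<Union>W\<in>\<K>. U W) \<and> \<Union>\<K> = am_exp ` (\<Union>W\<in>\<K>. U W)" by blast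
    then show "\<exists>U. openin \<tau> U \<and> \<Union>\<K> = am_exp ` U" by blast
  qed
  then show ?thesis by (simp add: exp_topology_def)
qed

lemma topspace_exp_topology: "topspace (exp_topology \<tau>) = am_exp ` topspace \<tau>"
  by (auto simp: topspace_def openin_exp_topology)

text \<open>The exponential is a homeomorphism onto its image with the transported topology, so
  complements correspond.\<close>

lemma closedin_exp_topology_image:
  "closedin (exp_topology \<tau>) (am_exp ` C) \<longleftrightarrow> closedin \<tau> C"
proof -
  have "openin (exp_topology \<tau>) (am_exp ` U) \<longleftrightarrow> openin \<tau> U" for U
    by (auto simp: openin_exp_topology inj_image_eq_iff[OF inj_am_exp])
  then show ?thesis
    by (simp add: closedin_def topspace_exp_topology inj_image_subset_iff[OF inj_am_exp]
        flip: image_set_diff[OF inj_am_exp])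
qed

section \<open>Transfer between return and monetary risk measures\<close>

lemma elog_le_iff: "0 < a \<Longrightarrow> 0 < b \<Longrightarrow> elog a \<le> elog b \<longleftrightarrow> a \<le> b"
  by (cases a; cases b) (auto simp: elog_def)

lemma elog_eq_iff: "0 < a \<Longrightarrow> 0 < b \<Longrightarrow> elog a = elog b \<longleftrightarrow> a = b"
  using elog_le_iff[of a b] elog_le_iff[of b a] by (metis order_antisym order_refl)

lemma elog_le_ereal_iff: "0 < a \<Longrightarrow> elog a \<le> ereal c \<longleftrightarrow> a \<le> ereal (exp c)"
  using exp_le_cancel_iff[of "ln (real_of_ereal a)" c] by (cases a) (auto simp: elog_def)

lemma elog_scale: "0 < a \<Longrightarrow> 0 < l \<Longrightarrow> elog (ereal l * a) = elog a + ereal (ln l)"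
  by (cases a) (auto simp: elog_def ln_mult)

text \<open>Positivity accompanies the formula because comparison through \<open>elog\<close> asks
  for it. An infinite factor makes both sides infinite, the other factor being positive.\<close>

lemma elog_epowr_mult:
  assumes "0 < a" "0 < b" "0 < s" "0 < t"
  shows "0 < epowr a s * epowr b t"
    and "elog (epowr a s * epowr b t) = ereal s * elog a + ereal t * elog b"
  using assms by (cases a; cases b; auto simp: elog_def epowr_def ln_mult ln_powr)+

lemma elog_not_MInfty: "elog a \<noteq> -\<infinity>"
  by (simp add: elog_def)

lemma elog_eq_PInfty_iff: "elog a = \<infinity> \<longleftrightarrow> a = \<infinity>"
  by (simp add: elog_def)

theorem proposition2p16:
  fixes \<rho>' :: "'a::am_algebra \<Rightarrow> ereal^'m"
    and \<rho> :: "'a \<Rightarrow> ereal^'m"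
  assumes "\<And>x i. x \<in> interior positive_cone \<Longrightarrow> 0 < \<rho>' x $ i"
    and "\<rho> = vlog \<circ> \<rho>' \<circ> am_exp"
  shows "(return_risk_measure \<rho>' \<longleftrightarrow> monetary_risk_measure \<rho>)
    \<and> (GG_convex \<rho>' \<longleftrightarrow> convex_map \<rho>)
    \<and> (\<forall>\<tau>::'a topology. topspace \<tau> = UNIV \<longrightarrow> (lsc (exp_topology \<tau>) \<rho>' \<longleftrightarrow> lsc \<tau> \<rho>))
    \<and> (CARD('m) = 1 \<longrightarrow>
         (\<forall>i. proper_on (interior positive_cone) (\<lambda>x. \<rho>' x $ i) \<longleftrightarrow> proper_on UNIV (\<lambda>x. \<rho> x $ i)))"
proof (intro conjI allI impI)
  have pos: "0 < \<rho>' (am_exp x) $ i" for x i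
    using assms(1) range_am_exp by blast
  have rho: "\<rho> x $ i = elog (\<rho>' (am_exp x) $ i)" for x i
    by (simp add: assms(2) vlog_def)
  \<comment> \<open>The exponential maps V onto the interior, so quantifiers over the interior
    become quantifiers over V.\<close>
  have ball: "(\<forall>x\<in>interior positive_cone. P x) \<longleftrightarrow> (\<forall>x. P (am_exp x))"
    and bex: "(\<exists>x\<in>interior positive_cone. P x) \<longleftrightarrow> (\<exists>x. P (am_exp x))" for P :: "'a \<Rightarrow> bool"
    by (auto simp flip: range_am_exp)
  have mono: "\<rho>' (am_exp x) \<le> \<rho>' (am_exp y) \<longleftrightarrow> \<rho> x \<le> \<rho> y" for x y
    by (simp add: less_eq_vec_def rho elog_le_iff pos)
  have homogeneous: "\<rho>' (exp c *\<^sub>R am_exp x) $ i = ereal (exp c) * \<rho>' (am_exp x) $ i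
      \<longleftrightarrow> \<rho> (x + c *\<^sub>R \<e>) $ i = \<rho> x $ i + ereal c" for x c i
  proof -
    have "0 < ereal (exp c) * \<rho>' (am_exp x) $ i" using pos by (simp add: ereal_zero_less_0_iff)
    then have "\<rho>' (am_exp (x + c *\<^sub>R \<e>)) $ i = ereal (exp c) * \<rho>' (am_exp x) $ i
      \<longleftrightarrow> elog (\<rho>' (am_exp (x + c *\<^sub>R \<e>)) $ i) = elog (ereal (exp c) * \<rho>' (am_exp x) $ i)"
      using pos by (simp add: elog_eq_iff)
    then show ?thesis by (simp add: rho elog_scale[OF pos] am_exp_translate)
  qed
  \<comment> \<open>Every positive scalar is \<open>exp c\<close> for a real \<open>c\<close>, so
    homogeneity and translation are indexed alike.\<close>
  have scales: "(\<forall>l>0. P l) \<longleftrightarrow> (\<forall>c. P (exp c))" for P :: "real \<Rightarrow> bool"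
    by (metis exp_gt_zero exp_ln)
  show "return_risk_measure \<rho>' \<longleftrightarrow> monetary_risk_measure \<rho>"
    unfolding return_risk_measure_def monetary_risk_measure_def ball scales
    by (simp add: pos am_exp_le_iff mono homogeneous)
  \<comment> \<open>Both sides of the geometric inequality are positive, so applying
    \<open>elog\<close> yields an equivalent inequality, namely the convexity of
    \<open>\<rho>\<close> at the same \<open>x\<close>, \<open>y\<close>, \<open>l\<close>.\<close>
  have "\<rho>' (am_powr (am_exp x) l * am_powr (am_exp y) (1 - l)) $ i
        \<le> epowr (\<rho>' (am_exp x) $ i) l * epowr (\<rho>' (am_exp y) $ i) (1 - l)
      \<longleftrightarrow> \<rho> (l *\<^sub>R x + (1 - l) *\<^sub>R y) $ i \<le> ereal l * \<rho> x $ i + ereal (1 - l) * \<rho> y $ i"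
    if "0 < l \<and> l < 1" for x y l i
    using elog_epowr_mult[OF pos[of x i] pos[of y i], of l "1 - l"] that elog_le_iff pos
    by (simp add: rho flip: am_exp_combination) (metis elog_le_iff pos)
  then show "GG_convex \<rho>' \<longleftrightarrow> convex_map \<rho>"
    unfolding GG_convex_def convex_map_def ball by blast
  show "lsc (exp_topology \<tau>) \<rho>' \<longleftrightarrow> lsc \<tau> \<rho>" if \<tau>: "topspace \<tau> = UNIV" for \<tau>
  proof -
    have sublevel: "closedin (exp_topology \<tau>) {x \<in> topspace (exp_topology \<tau>). \<rho>' x $ i \<le> ereal a}
        \<longleftrightarrow> closedin \<tau> {x. \<rho>' (am_exp x) $ i \<le> ereal a}" for i a
    proof -
      have "{x \<in> topspace (exp_topology \<tau>). \<rho>' x $ i \<le> ereal a}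
          = am_exp ` {x. \<rho>' (am_exp x) $ i \<le> ereal a}"
        by (auto simp: topspace_exp_topology \<tau>)
      then show ?thesis by (simp add: closedin_exp_topology_image)
    qed
    \<comment> \<open>The real levels \<open>c\<close> of \<open>\<rho>\<close> correspond to the
      positive levels \<open>exp c\<close> of \<open>\<rho>'\<close>; at the remaining levels the
      sublevel set of \<open>\<rho>'\<close> is empty, hence closed.\<close>
    have nonpos: "{x. \<rho>' (am_exp x) $ i \<le> ereal a} = {}" if "\<not> 0 < a" for i a
    proof -
      have "ereal a \<le> 0" using that by simp
      from le_less_trans[OF this pos] show ?thesis by (auto simp: not_le)
    qed
    have "lsc (exp_topology \<tau>) \<rho>' \<longleftrightarrow>
        (\<forall>i. \<forall>a>0. closedin \<tau> {x. \<rho>' (am_exp x) $ i \<le> ereal a})"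
      unfolding lsc_def sublevel using nonpos by (metis closedin_empty)
    also have "\<dots> \<longleftrightarrow> lsc \<tau> \<rho>"
      unfolding lsc_def scales by (simp add: \<tau> rho elog_le_ereal_iff[OF pos])
    finally show ?thesis .
  qed
  show "proper_on (interior positive_cone) (\<lambda>x. \<rho>' x $ i) \<longleftrightarrow> proper_on UNIV (\<lambda>x. \<rho> x $ i)" for i
  proof -
    \<comment> \<open>Neither map takes the value -\<infinity>, so properness of each says that some
      value is finite, and \<open>elog\<close> preserves finiteness both ways.\<close>
    have "\<rho>' (am_exp x) $ i \<noteq> -\<infinity>" for x using pos[of x i] by auto
    then show ?thesis
      unfolding proper_on_def ball bex by (simp add: rho elog_not_MInfty elog_eq_PInfty_iff)
  qed
qed

end
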